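(* Let $(b,a,c)$ be a Markov triple in which $a$ is the largest entry, and let $q$ be an integer with $q\equiv 3cb^{-1}\pmod a$. Define $b_0=b$, $c_0=c$ and recursively $b_{n+1}=c_n$, $c_{n+1}=3ac_n-b_n$. For $n\in\mathbb{N}=\{1,2,\dots\}$ let $\Delta_n^{a,\beta}$ be the translate by the vector $\big(-\frac{q}{3a},-\frac13\big)$ of the triangle with vertices $$(0,0),\qquad \Big(\frac{c_n}{ab_n},0\Big),\qquad \Big(\frac{(aq-1)b_n}{ac_n},\frac{ab_n}{c_n}\Big),$$ and let $\Delta_\infty^{a,\beta}$ be the translate by the same vector $\big(-\frac{q}{3a},-\frac13\big)$ of the triangle with vertices $$(0,0),\qquad (\lambda(a),0),\qquad \frac{1}{a^2\lambda(a)}\,(aq-1,a^2),\qquad \lambda(a)=\frac{3+\sqrt{9-4/a^2}}{2}.$$ Then $\Delta_\infty^{a,\beta}$ is Ehrhart equivalent to $\Delta_n^{a,\beta}$ for every $n\in\mathbb{N}$. In particular, the Ehrhart function of $3\Delta_\infty^{a,\beta}$ is a polynomial (i.e. $3\Delta_\infty^{a,\beta}$ is pseudo-integral).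
   Context: A Markov triple is a triple of positive integers $(p_1,p_2,p_3)$ with $p_1^2+p_2^2+p_3^2=3p_1p_2p_3$; its entries are pairwise coprime. For a polygon $P\subset\mathbb{R}^2$, its Ehrhart function is $L_P(t)=\#\big((tP)\cap\mathbb{Z}^2\big)$ for integers $t\ge0$; two polygons are Ehrhart equivalent if their Ehrhart functions coincide; a polygon is pseudo-integral if its Ehrhart function is a polynomial in $t$. (The translation vector is chosen so that the integral barycentre $(\frac{q}{3a},\frac13)$ of the untranslated triangles is moved to the origin.) *)

theory Defs
  imports
    "HOL-Analysis.Analysis"
    "HOL-Computational_Algebra.Polynomial"
    "HOL-Number_Theory.Modular_Inverse"
begin

definition markov_triple :: "int \<Rightarrow> int \<Rightarrow> int \<Rightarrow> bool" where
  "markov_triple p1 p2 p3 \<longleftrightarrow>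
     p1 > 0 \<and> p2 > 0 \<and> p3 > 0 \<and> p1\<^sup>2 + p2\<^sup>2 + p3\<^sup>2 = 3 * p1 * p2 * p3"

definition int_lattice :: "(real \<times> real) set" where
  "int_lattice = \<int> \<times> \<int>"

definition dilate :: "real \<Rightarrow> (real \<times> real) set \<Rightarrow> (real \<times> real) set" where
  "dilate r P = (\<lambda>v. r *\<^sub>R v) ` P"

text \<open>Meaningful for bounded \<open>P\<close> only, since \<^const>\<open>card\<close> is \<open>0\<close> on infinite sets.\<close>

definition ehrhart :: "(real \<times> real) set \<Rightarrow> nat \<Rightarrow> nat" where
  "ehrhart P t = card (dilate (real t) P \<inter> int_lattice)"

definition ehrhart_equivalent :: "(real \<times> real) set \<Rightarrow> (real \<times> real) set \<Rightarrow> bool" where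
  "ehrhart_equivalent P Q \<longleftrightarrow> (\<forall>t. ehrhart P t = ehrhart Q t)"

definition pseudo_integral :: "(real \<times> real) set \<Rightarrow> bool" where
  "pseudo_integral P \<longleftrightarrow> (\<exists>f :: real poly. \<forall>t. real (ehrhart P t) = poly f (real t))"

fun b_seq :: "int \<Rightarrow> int \<Rightarrow> int \<Rightarrow> nat \<Rightarrow> int"
  and c_seq :: "int \<Rightarrow> int \<Rightarrow> int \<Rightarrow> nat \<Rightarrow> int" where
  "b_seq a b c 0 = b"
| "b_seq a b c (Suc n) = c_seq a b c n"
| "c_seq a b c 0 = c"
| "c_seq a b c (Suc n) = 3 * a * c_seq a b c n - b_seq a b c n"

definition shift_vec :: "int \<Rightarrow> int \<Rightarrow> real \<times> real" where
  "shift_vec a q = (- (of_int q / (3 * of_int a)), - (1 / 3))"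

definition markov_triangle :: "int \<Rightarrow> int \<Rightarrow> int \<Rightarrow> int \<Rightarrow> nat \<Rightarrow> (real \<times> real) set" where
  "markov_triangle a b c q n =
     (let A = real_of_int a; Q = real_of_int q;
          B = real_of_int (b_seq a b c n); C = real_of_int (c_seq a b c n)
      in (+) (shift_vec a q) ` (convex hull
           {(0, 0), (C / (A * B), 0), ((A * Q - 1) * B / (A * C), A * B / C)}))"

definition lambda_lim :: "int \<Rightarrow> real" where
  "lambda_lim a = (3 + sqrt (9 - 4 / (real_of_int a)\<^sup>2)) / 2"

definition markov_triangle_lim :: "int \<Rightarrow> int \<Rightarrow> (real \<times> real) set" where
  "markov_triangle_lim a q =
     (let A = real_of_int a; Q = real_of_int q; l = lambda_lim a
      in (+) (shift_vec a q) ` (convex hull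
           {(0, 0), (l, 0), (1 / (A\<^sup>2 * l)) *\<^sub>R (A * Q - 1, A\<^sup>2)}))"

end

theory Submission
  imports Defs
begin

text \<open>
  After the shift all three edges of the dilated triangle \<open>t\<Delta>\<^sub>n\<close> lie on lines
  \<open>\<ell> = t/3\<close> with \<open>\<ell>\<close> an integral linear form, so only \<open>s = t div 3\<close> matters. The lattice points on
  which the maximum of the three forms is exactly \<open>s\<close> are the lattice points on the boundary of a
  triangle whose lattice perimeter is \<open>3s(a\<^sup>2 + b\<^sub>n\<^sup>2 + c\<^sub>n\<^sup>2)/(ab\<^sub>nc\<^sub>n) = 9s\<close>. Consecutive edges
  can be parametrised so that their common vertex has the same fractional position on both;
  hence the rounding errors cancel and the boundary carries exactly \<open>9s\<close> lattice points. For the limit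
  triangle the third edge is \<open>x + (3\<lambda> - q/a) y \<le> 0\<close>, independent of \<open>t\<close>, and its only lattice point is
  the origin; the lengths of the other two edges add up to \<open>3s(\<lambda> + 1/(a\<^sup>2\<lambda>)) = 9s\<close>, and the same
  cancellation applies because their outer ends are irrational. So both Ehrhart functions equal
  \<open>1 + 9s(s + 1)/2\<close>.
\<close>

section \<open>Markov triples\<close>

text \<open>Vieta jumping: \<open>z\<close> and \<open>w = 3xy - z\<close> are the roots of
  \<open>T^2 - 3xyT + x^2 + y^2\<close>. Since \<open>1 <= x <= y\<close>, this quadratic is
  nonpositive at \<open>T = y\<close>, so \<open>y\<close> lies between the roots and
  \<open>y < z\<close> forces \<open>w <= y < z\<close>. If \<open>y = z\<close>, the equation
  collapses to \<open>x^2 = z^2 (3x - 2)\<close>, which leaves only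
  \<open>(1, 1, 1)\<close>.\<close>

lemma markov_descent:
  assumes "markov_triple x y z" "x \<le> y" "y \<le> z"
  shows "(x = 1 \<and> y = 1 \<and> z = 1) \<or> (markov_triple x y (3 * x * y - z) \<and> 3 * x * y - z < z)"
proof -
  have pos: "x > 0" "y > 0" "z > 0" and eq: "x\<^sup>2 + y\<^sup>2 + z\<^sup>2 = 3 * x * y * z"
    using assms(1) unfolding markov_triple_def by auto
  define w where "w = 3 * x * y - z"
  have zw: "z * w = x\<^sup>2 + y\<^sup>2" using eq by (simp add: w_def power2_eq_square algebra_simps)
  then have "z * w > 0" using pos by (simp add: add_pos_pos)
  then have w0: "w > 0" using pos by (simp add: zero_less_mult_iff)
  have "x\<^sup>2 + y\<^sup>2 + w\<^sup>2 = 3 * x * y * w"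
    using zw by (simp add: w_def power2_eq_square algebra_simps)
  then have mw: "markov_triple x y w" using pos w0 unfolding markov_triple_def by auto
  have "x * x \<le> y * y" using assms pos by (intro mult_mono) auto
  have "1 * (y * y) \<le> x * (y * y)" using pos by (intro mult_right_mono) auto
  then have "(y - z) * (y - w) \<le> 0"
    using zw \<open>x * x \<le> y * y\<close> by (simp add: w_def power2_eq_square algebra_simps)
  show ?thesis
  proof (cases "y = z")
    case False
    then have "y - z < 0" using assms by simp
    then have "y - w \<ge> 0" using \<open>(y - z) * (y - w) \<le> 0\<close> by (simp add: mult_le_0_iff)
    then show ?thesis using mw False assms unfolding w_def by auto
  next
    case True
    then have e: "x * x = z * z * (3 * x - 2)" using eq by (simp add: power2_eq_square algebra_simps)
    have "z * z * 1 \<le> z * z * (3 * x - 2)" using pos by (intro mult_left_mono) auto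
    then have "z * z \<le> x * x" using e by simp
    then have "z \<le> x" using pos by (meson mult_strict_mono not_le less_imp_le)
    then have xz: "x = z" using assms True by simp
    then have "z * z * 1 = z * z * (3 * z - 2)" using e by simp
    then have "z = 1" using pos by (simp only: mult_cancel_left) auto
    then show ?thesis using xz True by auto
  qed
qed

lemma markov_triple_commute:
  "markov_triple x y z \<Longrightarrow> markov_triple y x z" "markov_triple x y z \<Longrightarrow> markov_triple x z y"
  unfolding markov_triple_def by (auto simp: algebra_simps)

text \<open>A common divisor survives the jump that replaces the largest entry, and repeated jumps,
  which decrease the sum of the entries, end at \<open>(1, 1, 1)\<close>.\<close>

lemma markov_common_divisor:
  fixes d :: int
  assumes "markov_triple x y z" "d dvd x" "d dvd y" "d dvd z"
  shows "d dvd 1"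
  using assms
proof (induction "nat (x + y + z)" arbitrary: x y z rule: less_induct)
  case less
  have sorted: "d dvd 1"
    if h: "markov_triple u v w" "u \<le> v" "v \<le> w" "d dvd u" "d dvd v" "d dvd w"
      "u + v + w = x + y + z" for u v w
    using markov_descent[OF h(1-3)]
  proof
    assume "u = 1 \<and> v = 1 \<and> w = 1"
    then show ?thesis using h by simp
  next
    assume m: "markov_triple u v (3 * u * v - w) \<and> 3 * u * v - w < w"
    then have "u > 0" "v > 0" "3 * u * v - w > 0" unfolding markov_triple_def by auto
    then have "nat (u + v + (3 * u * v - w)) < nat (x + y + z)" using m h(7) by linarith
    then show ?thesis using less(1) m h by (meson dvd_diff dvd_mult dvd_trans)
  qed
  have perms: "markov_triple x y z" "markov_triple x z y" "markov_triple y x z"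
    "markov_triple y z x" "markov_triple z x y" "markov_triple z y x"
    using less.prems(1) markov_triple_commute by blast+
  consider "x \<le> y" "y \<le> z" | "x \<le> z" "z \<le> y" | "y \<le> x" "x \<le> z"
    | "y \<le> z" "z \<le> x" | "z \<le> x" "x \<le> y" | "z \<le> y" "y \<le> x"
    by linarith
  then show ?case
  proof cases
    case 1 then show ?thesis using sorted[of x y z] perms less.prems by simp
  next
    case 2 then show ?thesis using sorted[of x z y] perms less.prems by simp
  next
    case 3 then show ?thesis using sorted[of y x z] perms less.prems by simp
  next
    case 4 then show ?thesis using sorted[of y z x] perms less.prems by simp
  next
    case 5 then show ?thesis using sorted[of z x y] perms less.prems by simp
  next
    case 6 then show ?thesis using sorted[of z y x] perms less.prems by simp
  qed
qed

text \<open>Modulo a prime dividing \<open>x\<close> and \<open>y\<close> the Markov equation reads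
  \<open>z^2 = 0\<close>, so that prime would divide all three entries.\<close>

lemma markov_coprime:
  assumes "markov_triple x y z"
  shows "coprime x y"
proof (rule ccontr)
  assume "\<not> coprime x y"
  moreover have "x \<noteq> 0" using assms unfolding markov_triple_def by simp
  ultimately obtain p where p: "prime p" "p dvd x" "p dvd y"
    using prime_factor_int[of "gcd x y"]
    by (metis abs_gcd_int coprime_iff_gcd_eq_1 dvd_trans gcd_dvd1 gcd_dvd2)
  have "z\<^sup>2 = x * (3 * y * z - x) - y * y"
    using assms unfolding markov_triple_def by (simp add: power2_eq_square algebra_simps)
  then have "p dvd z\<^sup>2" using p by simp
  then have "p dvd z" using p prime_dvd_power by blast
  then have "p dvd 1" using markov_common_divisor assms p by blast
  then show False using p by (meson not_prime_unit)
qed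

section \<open>Lattice points by layers\<close>

text \<open>The direction \<open>(aq - 1, a^2)\<close> and the solution
  \<open>(-q^2, -(aq + 1))\<close> for \<open>s = 1\<close> have determinant 1, because
  \<open>(aq - 1)(aq + 1) = a^2 q^2 - 1\<close>. They form a lattice basis, and \<open>m\<close> is
  the coordinate along the direction.\<close>

lemma wahl_line_iff:
  fixes a q s x y :: int
  shows "(a * q - 1) * y - a\<^sup>2 * x = s \<longleftrightarrow>
    (\<exists>m. x = (a * q - 1) * m - q\<^sup>2 * s \<and> y = a\<^sup>2 * m - (a * q + 1) * s)"
proof
  assume s: "(a * q - 1) * y - a\<^sup>2 * x = s"
  define m where "m = q\<^sup>2 * y - (a * q + 1) * x"
  have "x = (a * q - 1) * m - q\<^sup>2 * s" "y = a\<^sup>2 * m - (a * q + 1) * s"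
    unfolding m_def s[symmetric] by (simp_all add: power2_eq_square algebra_simps)
  then show "\<exists>m. x = (a * q - 1) * m - q\<^sup>2 * s \<and> y = a\<^sup>2 * m - (a * q + 1) * s" by blast
next
  assume "\<exists>m. x = (a * q - 1) * m - q\<^sup>2 * s \<and> y = a\<^sup>2 * m - (a * q + 1) * s"
  then obtain m where "x = (a * q - 1) * m - q\<^sup>2 * s" "y = a\<^sup>2 * m - (a * q + 1) * s" by blast
  then show "(a * q - 1) * y - a\<^sup>2 * x = s" by algebra
qed

text \<open>The layers contribute \<open>9 (1 + ... + s)\<close> points around a single central
  one.\<close>

lemma card_of_layers:
  fixes R E :: "nat \<Rightarrow> (int \<times> int) set"
  assumes "card (R 0) = 1"
    and "\<And>s. R (Suc s) = R s \<union> E (Suc s)" and "\<And>s. R s \<inter> E (Suc s) = {}"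
    and "\<And>s. finite (E (Suc s))" and "\<And>s. card (E (Suc s)) = 9 * Suc s"
  shows "real (card (R s)) = 1 + 9 * real s * (real s + 1) / 2"
proof -
  have "finite (R s) \<and> real (card (R s)) = 1 + 9 * real s * (real s + 1) / 2"
  proof (induction s)
    case 0
    have "finite (R 0)" using assms(1) by (metis card.infinite zero_neq_one)
    then show ?case using assms(1) by simp
  next
    case (Suc s)
    have "card (R (Suc s)) = card (R s) + 9 * Suc s"
      using Suc assms(2-5) by (metis card_Un_disjoint)
    then show ?case using Suc assms(2,4) by (simp add: field_simps)
  qed
  then show ?thesis by simp
qed

section \<open>Layer count for the triangle of a Markov triple\<close>

text \<open>The lattice points of the shifted triangle dilated by \<open>t\<close>, with
  \<open>s = t div 3\<close>; the forms belong to the bottom, left and right edge. The right form is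
  the left one reflected by \<open>x -> -x\<close>, with \<open>(b, p)\<close> in place of
  \<open>(a, q)\<close>.\<close>

definition triangle_points :: "int \<Rightarrow> int \<Rightarrow> int \<Rightarrow> int \<Rightarrow> nat \<Rightarrow> (int \<times> int) set" where
  "triangle_points a q b p s = {(x, y). - y \<le> int s \<and> (a * q - 1) * y - a\<^sup>2 * x \<le> int s
     \<and> b\<^sup>2 * x + (b * p - 1) * y \<le> int s}"

lemma of_int_divide_compare_iff:
  fixes a m q :: int assumes "a > 0"
  shows "real_of_int q / real_of_int a \<le> real_of_int m \<longleftrightarrow> q \<le> a * m"
    and "real_of_int m < real_of_int q / real_of_int a \<longleftrightarrow> a * m < q"
proof -
  have "real_of_int q / real_of_int a \<le> real_of_int m \<longleftrightarrow> real_of_int q \<le> real_of_int (a * m)"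
    using assms by (simp add: field_simps)
  then show "real_of_int q / real_of_int a \<le> real_of_int m \<longleftrightarrow> q \<le> a * m" by linarith
  then show "real_of_int m < real_of_int q / real_of_int a \<longleftrightarrow> a * m < q" by linarith
qed

text \<open>The condition on \<open>p\<close> gives the bottom edge lattice length
  \<open>3cs/(ab)\<close>. The main point is an integer \<open>r\<close> that places the top vertex
  at \<open>rs/c\<close> on the right edge and at \<open>9s - rs/c\<close> on the left edge: the two
  roundings at this vertex then cancel.\<close>

lemma card_triangle_points:
  assumes mk: "markov_triple b a c" and p: "a * p = 3 * c - q * b"
  shows "real (card (triangle_points a q b p s)) = 1 + 9 * real s * (real s + 1) / 2"
proof -
  have pos: "a > 0" "b > 0" "c > 0" and eq: "a * a + b * b + c * c = 3 * a * b * c"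
    using mk unfolding markov_triple_def by (auto simp: power2_eq_square algebra_simps)
  have "coprime b c" using mk markov_coprime markov_triple_commute by blast
  \<comment> \<open>On the right edge the left form reaches level \<open>s\<close> where
    \<open>c^2 m = D s\<close>. Divisibility of \<open>D\<close> by \<open>c\<close> reduces the
    denominator of this position from \<open>c^2\<close> to \<open>c\<close>; it is proved for
    \<open>b D\<close> first, and \<open>b\<close> is coprime to \<open>c\<close>.\<close>
  define D where "D = 3 * a * c * p + a * q - b * p"
  have "b * D = p * (3 * a * b * c) + a * (b * q) - b * b * p"
    by (simp add: D_def algebra_simps)
  also have "\<dots> = p * (a * a + c * c) + a * (b * q)" using eq by algebra
  also have "\<dots> = p * c * c + a * (a * p) + a * (b * q)" by (simp add: algebra_simps)
  also have "\<dots> = c * (p * c + 3 * a)" by (simp only: p) (simp add: algebra_simps)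
  finally have bD: "b * D = c * (p * c + 3 * a)" .
  then have "c dvd D" using \<open>coprime b c\<close>
    by (metis coprime_commute coprime_dvd_mult_right_iff dvd_triv_left)
  then obtain r where r: "D = c * r" by blast
  \<comment> \<open>The difference \<open>br - pc = 3a\<close> yields the lattice length
    \<open>3as/(bc)\<close> of the right edge; \<open>left_len\<close> below does the same for the
    left edge.\<close>
  have br: "b * r = p * c + 3 * a"
  proof -
    have "c * (b * r) = c * (p * c + 3 * a)" using bD r by (simp add: algebra_simps)
    then show ?thesis using pos by simp
  qed
  \<comment> \<open>The left edge meets the right line where \<open>c^2 m\<close> equals this
    left-hand side times \<open>s\<close>, that is, at \<open>m = 9s - rs/c\<close>.\<close>
  have r': "3 * b * c * q + b * p - a * q = c * (9 * c - r)"
  proof -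
    have "c * (9 * c - r) = 9 * c * c - 3 * c * (a * p) - a * q + b * p"
      using r by (simp add: D_def algebra_simps)
    then show ?thesis by (simp only: p) (simp add: algebra_simps)
  qed
  have "b * (a * (9 * c - r) - q * c) = b * (3 * b)"
  proof -
    have "b * (a * (9 * c - r) - q * c) = 9 * a * b * c - a * (b * r) - q * b * c"
      by (simp add: algebra_simps)
    also have "\<dots> = 3 * (3 * a * b * c) - c * (a * p) - 3 * a * a - q * b * c"
      by (simp only: br) (simp add: algebra_simps)
    also have "\<dots> = 3 * (a * a + b * b + c * c) - c * (3 * c - q * b) - 3 * a * a - q * b * c"
      by (simp only: p eq)
    finally show ?thesis by (simp add: algebra_simps)
  qed
  then have left_len: "a * (9 * c - r) - q * c = 3 * b" using pos by simp
  \<comment> \<open>\<open>c^2\<close> is the change of either upper form along one primitive step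
    of the other upper edge.\<close>
  have coef: "b\<^sup>2 * (a * q - 1) + a\<^sup>2 * (b * p - 1) = c\<^sup>2"
  proof -
    have "b\<^sup>2 * (a * q - 1) + a\<^sup>2 * (b * p - 1) = a * b * b * q + a * b * (a * p) - b * b - a * a"
      by (simp add: power2_eq_square algebra_simps)
    also have "\<dots> = 3 * a * b * c - b * b - a * a" by (simp only: p) (simp add: algebra_simps)
    finally show ?thesis using eq by (simp add: power2_eq_square)
  qed
  \<comment> \<open>The three forms have a positive linear relation, so the level-0 region is a point.\<close>
  have balance: "b\<^sup>2 * ((a * q - 1) * y - a\<^sup>2 * x) + a\<^sup>2 * (b\<^sup>2 * x + (b * p - 1) * y) = c\<^sup>2 * y" for x y
    by (simp add: coef[symmetric] algebra_simps)
  let ?R = "triangle_points a q b p"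
  \<comment> \<open>The three edges, each half-open so that every vertex is counted once; the position of the top
    vertex on the left edge is \<open>9s - rs/c\<close>, which is where the sum \<open>9s\<close> comes from.\<close>
  define E1 where "E1 s = (\<lambda>x. (x, - int s)) `
    {\<lceil>of_int (- q * s) / real_of_int a\<rceil> ..< \<lceil>of_int (p * s) / real_of_int b\<rceil>}" for s :: nat
  define E2 where "E2 s = (\<lambda>m. (p\<^sup>2 * s - (b * p - 1) * m, b\<^sup>2 * m - (b * p + 1) * s)) `
    {\<lceil>of_int (p * s) / real_of_int b\<rceil> ..< \<lceil>of_int (r * s) / real_of_int c\<rceil>}" for s :: nat
  define E3 where "E3 s = (\<lambda>m. ((a * q - 1) * m - q\<^sup>2 * s, a\<^sup>2 * m - (a * q + 1) * s)) `
    {- \<lceil>of_int (- q * s) / real_of_int a\<rceil> <.. 9 * int s - \<lceil>of_int (r * s) / real_of_int c\<rceil>}" for s :: nat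
  define l2 l3 where "l2 x y = (a * q - 1) * y - a\<^sup>2 * x" and "l3 x y = b\<^sup>2 * x + (b * p - 1) * y" for x y
  have R: "?R s = {(x, y). - y \<le> int s \<and> l2 x y \<le> int s \<and> l3 x y \<le> int s}" for s
    unfolding triangle_points_def l2_def l3_def ..
  have bal: "b\<^sup>2 * l2 x y + a\<^sup>2 * l3 x y + c\<^sup>2 * (- y) = 0" for x y
    using balance unfolding l2_def l3_def by simp
  have E1: "E1 s = {(x, y). - y = int s \<and> l2 x y \<le> int s \<and> l3 x y < int s}" for s
  proof -
    have 1: "l2 x (- int s) \<le> int s \<longleftrightarrow> - q * s \<le> a * x" for x
    proof -
      have "l2 x (- int s) \<le> int s \<longleftrightarrow> a * (- q * s) \<le> a * (a * x)"
        unfolding l2_def by (auto simp: power2_eq_square algebra_simps)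
      then show ?thesis by (simp only: mult_le_cancel_left_pos[OF pos(1)] mult_less_cancel_left_pos[OF pos(1)]
          mult_le_cancel_left_pos[OF pos(2)] mult_less_cancel_left_pos[OF pos(2)]
          mult_le_cancel_left_pos[OF pos(3)] mult_less_cancel_left_pos[OF pos(3)])
    qed
    have 2: "l3 x (- int s) < int s \<longleftrightarrow> b * x < p * s" for x
    proof -
      have "l3 x (- int s) < int s \<longleftrightarrow> b * (b * x) < b * (p * s)"
        unfolding l3_def by (auto simp: power2_eq_square algebra_simps)
      then show ?thesis by (simp only: mult_le_cancel_left_pos[OF pos(1)] mult_less_cancel_left_pos[OF pos(1)]
          mult_le_cancel_left_pos[OF pos(2)] mult_less_cancel_left_pos[OF pos(2)]
          mult_le_cancel_left_pos[OF pos(3)] mult_less_cancel_left_pos[OF pos(3)])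
    qed
    have "E1 s = (\<lambda>x. (x, - int s)) ` {x. - q * s \<le> a * x \<and> b * x < p * s}"
      unfolding E1_def
      by (simp only: atLeastLessThan_def atLeast_def lessThan_def Int_def mem_Collect_eq
          ceiling_le_iff less_ceiling_iff of_int_divide_compare_iff[OF pos(1)] of_int_divide_compare_iff[OF pos(2)])
    also have "\<dots> = {(x, y). - y = int s \<and> l2 x y \<le> int s \<and> l3 x y < int s}"
      using 1 2 by (auto simp: image_iff) (metis add.inverse_inverse)+
    finally show ?thesis .
  qed
  have E2: "E2 s = {(x, y). l3 x y = int s \<and> - y \<le> int s \<and> l2 x y < int s}" for s
  proof -
    define X Y where "X m = p\<^sup>2 * s - (b * p - 1) * m" and "Y m = b\<^sup>2 * m - (b * p + 1) * s" for m
    have 1: "- Y m \<le> int s \<longleftrightarrow> p * s \<le> b * m" for m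
    proof -
      have "- Y m \<le> int s \<longleftrightarrow> b * (p * s) \<le> b * (b * m)"
        unfolding Y_def by (auto simp: power2_eq_square algebra_simps)
      then show ?thesis by (simp only: mult_le_cancel_left_pos[OF pos(1)] mult_less_cancel_left_pos[OF pos(1)]
          mult_le_cancel_left_pos[OF pos(2)] mult_less_cancel_left_pos[OF pos(2)]
          mult_le_cancel_left_pos[OF pos(3)] mult_less_cancel_left_pos[OF pos(3)])
    qed
    have 2: "l2 (X m) (Y m) < int s \<longleftrightarrow> c * m < r * s" for m
    proof -
      have "l2 (X m) (Y m) = (b\<^sup>2 * (a * q - 1) + a\<^sup>2 * (b * p - 1)) * m
          - (a * q * b * p + a * q - b * p - 1 + a * p * (a * p)) * s"
        unfolding l2_def X_def Y_def by (simp add: power2_eq_square algebra_simps)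
      also have "\<dots> = c\<^sup>2 * m - (D - 1) * s"
      proof -
        have "a * q * b * p + a * q - b * p - 1 + a * p * (a * p) = D - 1"
          unfolding D_def using p by algebra
        then show ?thesis by (simp only: coef)
      qed
      finally have "l2 (X m) (Y m) < int s \<longleftrightarrow> c * (c * m) < c * (r * s)"
        unfolding r by (auto simp: power2_eq_square algebra_simps)
      then show ?thesis by (simp only: mult_le_cancel_left_pos[OF pos(1)] mult_less_cancel_left_pos[OF pos(1)]
          mult_le_cancel_left_pos[OF pos(2)] mult_less_cancel_left_pos[OF pos(2)]
          mult_le_cancel_left_pos[OF pos(3)] mult_less_cancel_left_pos[OF pos(3)])
    qed
    \<comment> \<open>The reflection \<open>x -> -x\<close> turns the right line into a left line
      with parameters \<open>(b, p)\<close>.\<close>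
    have 3: "l3 x y = int s \<longleftrightarrow> (\<exists>m. x = X m \<and> y = Y m)" for x y
      using wahl_line_iff[of b p y "- x" s] pos unfolding l3_def X_def Y_def
      by (auto simp: algebra_simps)
    have "E2 s = (\<lambda>m. (X m, Y m)) ` {m. p * s \<le> b * m \<and> c * m < r * s}"
      unfolding E2_def X_def Y_def
      by (simp only: atLeastLessThan_def atLeast_def lessThan_def Int_def mem_Collect_eq
          ceiling_le_iff less_ceiling_iff of_int_divide_compare_iff[OF pos(2)] of_int_divide_compare_iff[OF pos(3)])
    also have "\<dots> = {(x, y). l3 x y = int s \<and> - y \<le> int s \<and> l2 x y < int s}"
      using 1 2 3 by auto
    finally show ?thesis .
  qed
  have E3: "E3 s = {(x, y). l2 x y = int s \<and> - y < int s \<and> l3 x y \<le> int s}" for s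
  proof -
    define X Y where "X m = (a * q - 1) * m - q\<^sup>2 * s" and "Y m = a\<^sup>2 * m - (a * q + 1) * s" for m
    have 1: "- Y m < int s \<longleftrightarrow> a * (- m) < - q * s" for m
    proof -
      have "- Y m < int s \<longleftrightarrow> a * (a * (- m)) < a * (- q * s)"
        unfolding Y_def by (auto simp: power2_eq_square algebra_simps)
      then show ?thesis by (simp only: mult_le_cancel_left_pos[OF pos(1)] mult_less_cancel_left_pos[OF pos(1)]
          mult_le_cancel_left_pos[OF pos(2)] mult_less_cancel_left_pos[OF pos(2)]
          mult_le_cancel_left_pos[OF pos(3)] mult_less_cancel_left_pos[OF pos(3)])
    qed
    have 2: "l3 (X m) (Y m) \<le> int s \<longleftrightarrow> r * s \<le> c * (9 * int s - m)" for m :: int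
    proof -
      have "l3 (X m) (Y m) = (b\<^sup>2 * (a * q - 1) + a\<^sup>2 * (b * p - 1)) * m
          - (b * q * (b * q) + b * p - 1 + a * q * b * p - a * q) * s"
        unfolding l3_def X_def Y_def by (simp add: power2_eq_square algebra_simps)
      also have "\<dots> = c\<^sup>2 * m - (c * (9 * c - r) - 1) * s"
      proof -
        have "b * q * (b * q) + b * p - 1 + a * q * b * p - a * q = c * (9 * c - r) - 1"
          unfolding r'[symmetric] using p by algebra
        then show ?thesis by (simp only: coef)
      qed
      finally have "l3 (X m) (Y m) \<le> int s \<longleftrightarrow> c * (r * s) \<le> c * (c * (9 * int s - m))"
        by (auto simp: power2_eq_square algebra_simps)
      then show ?thesis by (simp only: mult_le_cancel_left_pos[OF pos(1)] mult_less_cancel_left_pos[OF pos(1)]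
          mult_le_cancel_left_pos[OF pos(2)] mult_less_cancel_left_pos[OF pos(2)]
          mult_le_cancel_left_pos[OF pos(3)] mult_less_cancel_left_pos[OF pos(3)])
    qed
    have 3: "l2 x y = int s \<longleftrightarrow> (\<exists>m. x = X m \<and> y = Y m)" for x y
      using wahl_line_iff[of a q y x s] pos unfolding l2_def X_def Y_def by auto
    \<comment> \<open>The bounds of the left edge are expressed by the same ceilings that bound the
      other two edges, not by floors, so that they can cancel literally in the count.\<close>
    have 4: "- \<lceil>of_int u / real_of_int a\<rceil> < m \<longleftrightarrow> a * (- m) < u" for m u
      using less_ceiling_iff[of "- m" "of_int u / real_of_int a"] of_int_divide_compare_iff(2)[OF pos(1), of "- m" u]
      by linarith
    have 5: "m \<le> k - \<lceil>of_int u / real_of_int c\<rceil> \<longleftrightarrow> u \<le> c * (k - m)" for m u k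
      using ceiling_le_iff[of "of_int u / real_of_int c" "k - m"] of_int_divide_compare_iff(1)[OF pos(3), of u "k - m"]
      by linarith
    have "E3 s = (\<lambda>m. (X m, Y m)) ` {m. a * (- m) < - q * s \<and> r * s \<le> c * (9 * int s - m)}"
      unfolding E3_def X_def Y_def
      by (simp only: greaterThanAtMost_def greaterThan_def atMost_def Int_def mem_Collect_eq 4 5)
    also have "\<dots> = {(x, y). l2 x y = int s \<and> - y < int s \<and> l3 x y \<le> int s}"
      using 1 2 3 by auto
    finally show ?thesis .
  qed
  define E where "E s = E1 s \<union> E2 s \<union> E3 s" for s
  \<comment> \<open>The positive combination \<open>bal\<close> vanishes, so the three forms cannot
    share a positive value. Hence a point of the new layer lies on one or two edges, and the cyclic
    half-open convention covers it; three strict inequalities in a cycle would miss only a point on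
    all three.\<close>
  have not_all: "\<not> (- y = k \<and> l2 x y = k \<and> l3 x y = k)" if "k > 0" for x y k
  proof
    assume "- y = k \<and> l2 x y = k \<and> l3 x y = k"
    then have "(b\<^sup>2 + a\<^sup>2 + c\<^sup>2) * k = 0" using bal[of x y] by (simp add: algebra_simps)
    moreover have "b\<^sup>2 + a\<^sup>2 + c\<^sup>2 > 0" using pos by (simp add: add_pos_pos)
    ultimately show False using that by simp
  qed
  have layer: "?R (Suc s) = ?R s \<union> E (Suc s)" for s
  proof -
    have "u \<le> k + 1 \<and> v \<le> k + 1 \<and> w \<le> k + 1 \<longleftrightarrow> (u \<le> k \<and> v \<le> k \<and> w \<le> k)
        \<or> (u = k + 1 \<and> v \<le> k + 1 \<and> w < k + 1) \<or> (w = k + 1 \<and> u \<le> k + 1 \<and> v < k + 1)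
        \<or> (v = k + 1 \<and> u < k + 1 \<and> w \<le> k + 1)"
      if "\<not> (u = k + 1 \<and> v = k + 1 \<and> w = k + 1)" for u v w k :: int
      using that by presburger
    from this[OF not_all[of "int s + 1"]] show ?thesis
      unfolding R E_def E1 E2 E3 by (simp add: set_eq_iff add.commute)
  qed
  have disj: "?R s \<inter> E (Suc s) = {}" for s
    unfolding R E_def E1 E2 E3 by auto
  have R0: "?R 0 = {(0, 0)}"
  proof -
    have "x = 0 \<and> y = 0" if h: "- y \<le> 0" "l2 x y \<le> 0" "l3 x y \<le> 0" for x y
    proof -
      have "b\<^sup>2 * l2 x y \<le> 0" "a\<^sup>2 * l3 x y \<le> 0" "c\<^sup>2 * (- y) \<le> 0"
        using h pos by (simp_all add: mult_le_0_iff)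
      then have "b\<^sup>2 * l2 x y = 0" "c\<^sup>2 * (- y) = 0" using bal[of x y] by linarith+
      then have "l2 x y = 0" "y = 0" using pos by simp_all
      then show ?thesis using pos unfolding l2_def by simp
    qed
    moreover have "l2 0 0 = 0" "l3 0 0 = 0" unfolding l2_def l3_def by simp_all
    ultimately show ?thesis unfolding R by auto
  qed
  have fin: "finite (E1 s)" "finite (E2 s)" "finite (E3 s)" for s
    unfolding E1_def E2_def E3_def by simp_all
  have cardE: "card (E s) = 9 * s" for s
  proof -
    \<comment> \<open>The edges have nonnegative lengths, so no rounded interval is reversed and
      each cardinality is the plain difference of its bounds.\<close>
    have le1: "of_int (- q * s) / real_of_int a \<le> of_int (p * s) / real_of_int b"
    proof -
      have "(a * p + q * b) * s \<ge> 0" using pos unfolding p by simp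
      then have "real_of_int ((- q * s) * b) \<le> real_of_int ((p * s) * a)"
        unfolding of_int_le_iff by (simp add: algebra_simps)
      then show ?thesis using pos by (simp add: field_simps)
    qed
    have le2: "of_int (p * s) / real_of_int b \<le> of_int (r * s) / real_of_int c"
    proof -
      have "(b * r - p * c) * s \<ge> 0" using pos unfolding br by simp
      then have "real_of_int ((p * s) * c) \<le> real_of_int ((r * s) * b)"
        unfolding of_int_le_iff by (simp add: algebra_simps)
      then show ?thesis using pos by (simp add: field_simps)
    qed
    have le3: "of_int (r * s) / real_of_int c \<le> 9 * int s + of_int (- q * s) / real_of_int a"
    proof -
      have "(a * (9 * c - r) - q * c) * s \<ge> 0" using pos unfolding left_len by simp
      then have "real_of_int ((r * s) * a) \<le> real_of_int ((9 * s * a - q * s) * c)"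
        unfolding of_int_le_iff by (simp add: algebra_simps)
      then show ?thesis using pos by (simp add: field_simps)
    qed
    have c1: "\<lceil>of_int (- q * s) / real_of_int a\<rceil> \<le> \<lceil>of_int (p * s) / real_of_int b\<rceil>"
      using le1 by (rule ceiling_mono)
    have c2: "\<lceil>of_int (p * s) / real_of_int b\<rceil> \<le> \<lceil>of_int (r * s) / real_of_int c\<rceil>"
      using le2 by (rule ceiling_mono)
    have c3: "\<lceil>of_int (r * s) / real_of_int c\<rceil> \<le> 9 * int s + \<lceil>of_int (- q * s) / real_of_int a\<rceil>"
      using le3 by linarith
    have i2: "inj (\<lambda>m. (p\<^sup>2 * s - (b * p - 1) * m, b\<^sup>2 * m - (b * p + 1) * s))"
      using pos by (auto intro!: injI)
    have i3: "inj (\<lambda>m. ((a * q - 1) * m - q\<^sup>2 * s, a\<^sup>2 * m - (a * q + 1) * s))"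
      using pos by (auto intro!: injI)
    have i1: "inj (\<lambda>x. (x, - int s))" by (auto intro!: injI)
    have "int (card (E1 s)) = \<lceil>of_int (p * s) / real_of_int b\<rceil> - \<lceil>of_int (- q * s) / real_of_int a\<rceil>"
      unfolding E1_def card_image[OF inj_on_subset[OF i1 subset_UNIV]] card_atLeastLessThan_int
      using c1 by linarith
    moreover have "int (card (E2 s)) = \<lceil>of_int (r * s) / real_of_int c\<rceil> - \<lceil>of_int (p * s) / real_of_int b\<rceil>"
      unfolding E2_def card_image[OF inj_on_subset[OF i2 subset_UNIV]] card_atLeastLessThan_int
      using c2 by linarith
    moreover have "int (card (E3 s)) = 9 * int s - \<lceil>of_int (r * s) / real_of_int c\<rceil> + \<lceil>of_int (- q * s) / real_of_int a\<rceil>"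
      unfolding E3_def card_image[OF inj_on_subset[OF i3 subset_UNIV]] card_greaterThanAtMost_int
      using c3 by linarith
    \<comment> \<open>Each of the three ceilings occurs once with either sign, so only
      \<open>9s\<close> remains.\<close>
    ultimately have counts: "int (card (E1 s)) + int (card (E2 s)) + int (card (E3 s)) = 9 * int s"
      by linarith
    have "E1 s \<inter> E2 s = {}" "(E1 s \<union> E2 s) \<inter> E3 s = {}" unfolding E1 E2 E3 by auto
    then have "card (E s) = card (E1 s) + card (E2 s) + card (E3 s)"
      unfolding E_def using fin by (simp add: card_Un_disjoint)
    then have "int (card (E s)) = int (9 * s)" using counts by simp
    then show ?thesis by simp
  qed
  show ?thesis
  proof (rule card_of_layers[of ?R E])
    show "card (?R 0) = 1" unfolding R0 by simp
    show "?R (Suc s) = ?R s \<union> E (Suc s)" for s by (rule layer)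
    show "?R s \<inter> E (Suc s) = {}" for s by (rule disj)
    show "finite (E (Suc s))" for s unfolding E_def by (simp only: finite_Un fin simp_thms)
    show "card (E (Suc s)) = 9 * Suc s" for s by (rule cardE)
  qed
qed

section \<open>Layer count for the limit triangle\<close>

text \<open>The third form is \<open>a\<close> times \<open>x + (3l - q/a) y\<close>; its level is 0
  whatever \<open>s\<close> is, so the third edge always passes through the origin.\<close>

definition limit_points :: "int \<Rightarrow> int \<Rightarrow> real \<Rightarrow> nat \<Rightarrow> (int \<times> int) set" where
  "limit_points a q l s = {(x, y). - y \<le> int s \<and> (a * q - 1) * y - a\<^sup>2 * x \<le> int s
     \<and> of_int a * of_int x + (3 * of_int a * l - of_int q) * of_int y \<le> 0}"

text \<open>Of the limit value only its quadratic equation and its irrationality matter. The third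
  edge stays fixed, so a layer consists of points on the bottom and left lines only.\<close>

lemma card_limit_points:
  assumes a: "a > 0" and l: "l > 0" "of_int (a\<^sup>2) * l * (3 - l) = 1" "l \<notin> \<rat>"
  shows "real (card (limit_points a q l s)) = 1 + 9 * real s * (real s + 1) / 2"
proof -
  let ?R = "limit_points a q l"
  define A Q where "A = real_of_int a" and "Q = real_of_int q"
  have A: "A > 0" using a A_def by simp
  have Al: "A\<^sup>2 * l * (3 - l) = 1" using l(2) A_def by simp
  define l2 w where "l2 x y = (a * q - 1) * y - a\<^sup>2 * x"
    and "w x y = A * of_int x + (3 * A * l - Q) * of_int y" for x y
  have R: "?R s = {(x, y). - y \<le> int s \<and> l2 x y \<le> int s \<and> w x y \<le> 0}" for s
    unfolding limit_points_def l2_def w_def A_def Q_def ..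
  \<comment> \<open>\<open>z s\<close> is the abscissa where the third line meets the bottom line
    \<open>y = -s\<close>. In the parameter \<open>m\<close> of the left line the third line is met
    at \<open>9s - z s\<close>.\<close>
  define z where "z s = (3 * l - Q / A) * real s" for s :: nat
  define E1 where "E1 s = (\<lambda>x. (x, - int s)) ` {- \<lfloor>Q * s / A\<rfloor> .. \<lfloor>z s\<rfloor>}" for s :: nat
  define E2 where "E2 s = (\<lambda>m. ((a * q - 1) * m - q\<^sup>2 * s, a\<^sup>2 * m - (a * q + 1) * s)) `
    {\<lfloor>Q * s / A\<rfloor> <.. \<lfloor>9 * real s - z s\<rfloor>}" for s :: nat
  have floorQ: "k \<le> \<lfloor>Q * s / A\<rfloor> \<longleftrightarrow> a * k \<le> q * s" for k and s :: nat
  proof -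
    have "k \<le> \<lfloor>Q * s / A\<rfloor> \<longleftrightarrow> A * of_int k \<le> Q * s"
      using A by (simp add: le_floor_iff field_simps)
    also have "\<dots> \<longleftrightarrow> real_of_int (a * k) \<le> real_of_int (q * s)"
      unfolding A_def Q_def by simp
    finally show ?thesis unfolding of_int_le_iff .
  qed
  have E1: "E1 s = {(x, y). - y = int s \<and> l2 x y \<le> int s \<and> w x y \<le> 0}" for s
  proof -
    have 1: "l2 x (- int s) \<le> int s \<longleftrightarrow> - \<lfloor>Q * s / A\<rfloor> \<le> x" for x
    proof -
      have "l2 x (- int s) \<le> int s \<longleftrightarrow> a * (a * (- x)) \<le> a * (q * s)"
        unfolding l2_def by (auto simp: power2_eq_square algebra_simps)
      also have "\<dots> \<longleftrightarrow> - x \<le> \<lfloor>Q * s / A\<rfloor>"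
        by (simp only: mult_le_cancel_left_pos[OF a] floorQ)
      finally show ?thesis by linarith
    qed
    have 2: "w x (- int s) \<le> 0 \<longleftrightarrow> x \<le> \<lfloor>z s\<rfloor>" for x
      unfolding w_def z_def le_floor_iff using A by (simp add: field_simps)
    show ?thesis unfolding E1_def using 1 2 by (auto simp: image_iff) (metis add.inverse_inverse)+
  qed
  have E2: "E2 s = {(x, y). l2 x y = int s \<and> - y < int s \<and> w x y \<le> 0}" for s
  proof -
    define X Y where "X m = (a * q - 1) * m - q\<^sup>2 * s" and "Y m = a\<^sup>2 * m - (a * q + 1) * s" for m
    have 1: "- Y m < int s \<longleftrightarrow> \<lfloor>Q * s / A\<rfloor> < m" for m
    proof -
      have "- Y m < int s \<longleftrightarrow> a * (q * s) < a * (a * m)"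
        unfolding Y_def by (auto simp: power2_eq_square algebra_simps)
      also have "\<dots> \<longleftrightarrow> \<not> (m \<le> \<lfloor>Q * s / A\<rfloor>)"
        by (simp only: mult_less_cancel_left_pos[OF a] floorQ not_le)
      finally show ?thesis by linarith
    qed
    have 2: "w (X m) (Y m) \<le> 0 \<longleftrightarrow> m \<le> \<lfloor>9 * real s - z s\<rfloor>" for m
    proof -
      \<comment> \<open>On the left line \<open>w\<close> is affine in \<open>m\<close>; its slope
        \<open>A (3 A^2 l - 1)\<close> equals \<open>A^3 l^2\<close> by the quadratic equation. The
        extra factor \<open>A\<close> keeps the identity polynomial in
        \<open>A * z s\<close>.\<close>
      have "A * (w (X m) (Y m)) = A * (A ^ 3 * l\<^sup>2 * (of_int m - (9 * real s - z s)))"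
      proof -
        have Az: "A * z s = (3 * A * l - Q) * s" unfolding z_def using A by (simp add: field_simps)
        have "w (X m) (Y m) = A * ((A * Q - 1) * m - Q\<^sup>2 * s) + (3 * A * l - Q) * (A\<^sup>2 * m - (A * Q + 1) * s)"
          unfolding w_def X_def Y_def A_def Q_def by simp
        then show ?thesis using Az Al by algebra
      qed
      then have "w (X m) (Y m) = A ^ 3 * l\<^sup>2 * (of_int m - (9 * real s - z s))" using A by simp
      moreover have "A ^ 3 * l\<^sup>2 > 0" using A l by simp
      ultimately have "w (X m) (Y m) \<le> 0 \<longleftrightarrow> of_int m - (9 * real s - z s) \<le> 0"
        using mult_le_cancel_left_pos[of "A ^ 3 * l\<^sup>2" "of_int m - (9 * real s - z s)" 0] by simp
      then show ?thesis by (simp add: le_floor_iff)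
    qed
    have 3: "l2 x y = int s \<longleftrightarrow> (\<exists>m. x = X m \<and> y = Y m)" for x y
      using wahl_line_iff[of a q y x s] unfolding l2_def X_def Y_def by auto
    have "E2 s = (\<lambda>m. (X m, Y m)) ` {m. \<lfloor>Q * s / A\<rfloor> < m \<and> m \<le> \<lfloor>9 * real s - z s\<rfloor>}"
      unfolding E2_def X_def Y_def by (simp only: greaterThanAtMost_def greaterThan_def atMost_def Int_def mem_Collect_eq)
    also have "\<dots> = {(x, y). l2 x y = int s \<and> - y < int s \<and> w x y \<le> 0}"
      using 1 2 3 by auto
    finally show ?thesis .
  qed
  define E where "E s = E1 s \<union> E2 s" for s
  have layer: "?R (Suc s) = ?R s \<union> E (Suc s)" for s
    unfolding R E_def E1 E2 by auto
  have disj: "?R s \<inter> E (Suc s) = {}" for s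
    unfolding R E_def E1 E2 by auto
  have R0: "?R 0 = {(0, 0)}"
  proof -
    have "x = 0 \<and> y = 0" if h: "- y \<le> 0" "l2 x y \<le> 0" "w x y \<le> 0" for x y
    proof -
      have "real_of_int (l2 x y) = (A * Q - 1) * y - A\<^sup>2 * x" unfolding l2_def A_def Q_def by simp
      \<comment> \<open>This combination eliminates \<open>x\<close>, so at level 0 the two upper
        inequalities bound \<open>y\<close> above by 0, opposite to the bottom one.\<close>
      then have "A\<^sup>2 * l\<^sup>2 * of_int y = real_of_int (l2 x y) + A * w x y"
        unfolding w_def using Al by algebra
      also have "\<dots> \<le> 0" using h A by (simp add: add_nonpos_nonpos mult_le_0_iff)
      finally have "y = 0" using h A l by (simp add: mult_le_0_iff)
      moreover have "x \<ge> 0" using h(2) \<open>y = 0\<close> a unfolding l2_def by (simp add: zero_le_mult_iff)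
      moreover have "x \<le> 0" using h(3) \<open>y = 0\<close> A unfolding w_def by (simp add: mult_le_0_iff)
      ultimately show ?thesis by simp
    qed
    moreover have "l2 0 0 = 0" "w 0 0 = 0" unfolding l2_def w_def by simp_all
    ultimately show ?thesis unfolding R by auto
  qed
  have fin: "finite (E s)" for s
    unfolding E_def E1_def E2_def by simp
  have l3: "l < 3"
  proof -
    have "A\<^sup>2 * l > 0" using A l by simp
    then show ?thesis using Al by (metis diff_gt_0_iff_gt zero_less_mult_pos zero_less_one)
  qed
  have cardE: "card (E (Suc s)) = 9 * Suc s" for s
  proof -
    let ?s = "Suc s"
    \<comment> \<open>For a positive layer, \<open>z\<close> determines \<open>l\<close> rationally.
      Non-integrality makes the floors of \<open>z\<close> and \<open>9s - z\<close> add up to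
      \<open>9s - 1\<close>, and the closed interval in \<open>E1\<close> supplies the missing
      1.\<close>
    have "z ?s \<notin> \<int>"
    proof
      assume "z ?s \<in> \<int>"
      then have "z ?s \<in> \<rat>" using Ints_subset_Rats by blast
      then have "(z ?s / of_nat ?s + Q / A) / 3 \<in> \<rat>" unfolding A_def Q_def
        by (intro Rats_divide Rats_add Rats_of_nat Rats_of_int Rats_number_of)
      moreover have "(z ?s / of_nat ?s + Q / A) / 3 = l" unfolding z_def by simp
      ultimately show False using l by simp
    qed
    then have fl: "\<lfloor>9 * real ?s - z ?s\<rfloor> = 9 * int ?s - \<lfloor>z ?s\<rfloor> - 1"
    proof -
      have "of_int \<lfloor>z ?s\<rfloor> \<noteq> z ?s" using \<open>z ?s \<notin> \<int>\<close> by (metis Ints_of_int)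
      then have "of_int \<lfloor>z ?s\<rfloor> < z ?s" "z ?s < of_int \<lfloor>z ?s\<rfloor> + 1" by linarith+
      then show ?thesis by linarith
    qed
    \<comment> \<open>The two edges have lengths \<open>3ls\<close> and \<open>3(3 - l)s\<close>,
      both nonnegative because \<open>0 < l < 3\<close>.\<close>
    have "l * real ?s \<ge> 0" "l * real ?s \<le> 3 * real ?s"
      using l(1) l3 by (intro mult_nonneg_nonneg mult_right_mono; simp)+
    then have zb: "z ?s \<ge> - (Q * ?s / A)" "9 * real ?s - z ?s \<ge> Q * ?s / A"
      unfolding z_def left_diff_distrib times_divide_eq_left mult.assoc by linarith+
    have c1: "\<lfloor>z ?s\<rfloor> + \<lfloor>Q * ?s / A\<rfloor> + 1 \<ge> 0" using zb(1) by linarith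
    have c2: "\<lfloor>Q * ?s / A\<rfloor> \<le> \<lfloor>9 * real ?s - z ?s\<rfloor>" using zb(2) by (rule floor_mono)
    have i: "inj (\<lambda>m. ((a * q - 1) * m - q\<^sup>2 * ?s, a\<^sup>2 * m - (a * q + 1) * ?s))"
      using a by (auto intro!: injI)
    have k1: "int (card (E1 ?s)) = \<lfloor>z ?s\<rfloor> + \<lfloor>Q * ?s / A\<rfloor> + 1"
      unfolding E1_def using c1 by (simp add: card_image inj_on_def)
    have k2: "int (card (E2 ?s)) = \<lfloor>9 * real ?s - z ?s\<rfloor> - \<lfloor>Q * ?s / A\<rfloor>"
      unfolding E2_def card_image[OF inj_on_subset[OF i subset_UNIV]] using c2 by simp
    have "E1 ?s \<inter> E2 ?s = {}" unfolding E1 E2 by auto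
    then have "card (E ?s) = card (E1 ?s) + card (E2 ?s)"
      unfolding E_def by (intro card_Un_disjoint) (simp_all add: E1_def E2_def)
    then have "int (card (E ?s)) = int (9 * ?s)" using k1 k2 fl by simp
    then show ?thesis by linarith
  qed
  show ?thesis
  proof (rule card_of_layers[of ?R E])
    show "card (?R 0) = 1" unfolding R0 by simp
    show "?R (Suc s) = ?R s \<union> E (Suc s)" for s by (rule layer)
    show "?R s \<inter> E (Suc s) = {}" for s by (rule disj)
    show "finite (E (Suc s))" for s by (rule fin)
    show "card (E (Suc s)) = 9 * Suc s" for s by (rule cardE)
  qed
qed

section \<open>Ehrhart functions of the triangles\<close>

text \<open>The inequalities are the signs of the barycentric coordinates: \<open>n = Y/v\<close>,
  \<open>m = (vX - uY)/(lv)\<close> and \<open>1 - m - n\<close>.\<close>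

lemma mem_triangle_iff:
  fixes l u v :: real
  assumes "l > 0" "v > 0"
  shows "(X, Y) \<in> convex hull {(0, 0), (l, 0), (u, v)} \<longleftrightarrow>
    0 \<le> Y \<and> u * Y \<le> v * X \<and> v * X + (l - u) * Y \<le> l * v"
proof
  assume "(X, Y) \<in> convex hull {(0, 0), (l, 0), (u, v)}"
  then obtain m n where mn: "0 \<le> m" "0 \<le> n" "m + n \<le> 1" "X = m * l + n * u" "Y = n * v"
    unfolding convex_hull_3_alt by auto
  have "m * (l * v) \<ge> 0" "(m + n) * (l * v) \<le> 1 * (l * v)"
    using mn assms by (simp, intro mult_right_mono) auto
  then show "0 \<le> Y \<and> u * Y \<le> v * X \<and> v * X + (l - u) * Y \<le> l * v"
    using mn assms by (simp add: algebra_simps)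
next
  assume h: "0 \<le> Y \<and> u * Y \<le> v * X \<and> v * X + (l - u) * Y \<le> l * v"
  define m n where "m = (v * X - u * Y) / (l * v)" and "n = Y / v"
  have "m + n = (v * X + (l - u) * Y) / (l * v)"
    unfolding m_def n_def using assms by (simp add: field_simps)
  then have "0 \<le> m" "0 \<le> n" "m + n \<le> 1" using h assms unfolding m_def n_def by simp_all
  moreover have "X = m * l + n * u" "Y = n * v"
    unfolding m_def n_def using assms by (simp_all add: field_simps)
  ultimately show "(X, Y) \<in> convex hull {(0, 0), (l, 0), (u, v)}"
    unfolding convex_hull_3_alt by auto
qed

text \<open>A family of triangles of area 1/2 with a fixed corner cone at the origin before the
  shift. The value \<open>l = c_n/(a b_n)\<close> gives the finite triangles and
  \<open>l = lambda_lim a\<close> the limit.\<close>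

definition shifted_triangle :: "int \<Rightarrow> int \<Rightarrow> real \<Rightarrow> (real \<times> real) set" where
  "shifted_triangle a q l = (+) (shift_vec a q) ` (convex hull
     {(0, 0), (l, 0), ((of_int a * of_int q - 1) / (of_int a ^ 2 * l), 1 / l)})"

text \<open>The shift puts the bottom and left edges at the common level \<open>t/3\<close> for
  integral forms. Only the third edge depends on \<open>l\<close>, and \<open>(U, V)\<close> undoes
  the dilation and the shift.\<close>

lemma mem_dilate_shifted_triangle:
  fixes X Y t l :: real and a q :: int
  assumes t: "t > 0" and l: "l > 0" and a: "a > 0"
  defines "A \<equiv> real_of_int a" and "Q \<equiv> real_of_int q"
  shows "(X, Y) \<in> dilate t (shifted_triangle a q l) \<longleftrightarrow>
    - Y \<le> t / 3 \<and> (A * Q - 1) * Y - A\<^sup>2 * X \<le> t / 3 \<and>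
    X + (l\<^sup>2 + 1 / A\<^sup>2 - Q / A) * Y \<le> t * (l - (l\<^sup>2 + 1 / A\<^sup>2) / 3)"
proof -
  have A: "A > 0" using a A_def by simp
  define U V where "U = X / t + Q / (3 * A)" and "V = Y / t + 1 / 3"
  define P where "P = convex hull {(0, 0), (l, 0), ((A * Q - 1) / (A\<^sup>2 * l), 1 / l)}"
  have "(X, Y) \<in> dilate t (shifted_triangle a q l) \<longleftrightarrow> (U, V) \<in> P"
  proof
    assume "(X, Y) \<in> dilate t (shifted_triangle a q l)"
    then obtain u v where "(u, v) \<in> P" "X = t * (u - Q / (3 * A))" "Y = t * (v - 1 / 3)"
      unfolding dilate_def shifted_triangle_def shift_vec_def P_def A_def Q_def by auto
    moreover have "U = u" "V = v" unfolding U_def V_def using calculation t by simp_all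
    ultimately show "(U, V) \<in> P" by simp
  next
    assume "(U, V) \<in> P"
    moreover have "(X, Y) = t *\<^sub>R (shift_vec a q + (U, V))"
      unfolding U_def V_def shift_vec_def A_def Q_def using t by (simp add: field_simps)
    ultimately show "(X, Y) \<in> dilate t (shifted_triangle a q l)"
      unfolding dilate_def shifted_triangle_def P_def A_def Q_def by blast
  qed
  also have "\<dots> \<longleftrightarrow> 0 \<le> V \<and> (A * Q - 1) / (A\<^sup>2 * l) * V \<le> 1 / l * U \<and>
      1 / l * U + (l - (A * Q - 1) / (A\<^sup>2 * l)) * V \<le> l * (1 / l)"
    unfolding P_def using l by (intro mem_triangle_iff) auto
  also have "0 \<le> V \<longleftrightarrow> - Y \<le> t / 3"
  proof -
    have "V = (Y + t / 3) / t" unfolding V_def using t by (simp add: field_simps)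
    then show ?thesis using t by (auto simp: zero_le_divide_iff)
  qed
  also have "(A * Q - 1) / (A\<^sup>2 * l) * V \<le> 1 / l * U \<longleftrightarrow> (A * Q - 1) * Y - A\<^sup>2 * X \<le> t / 3"
  proof -
    have "(A * Q - 1) / (A\<^sup>2 * l) * V \<le> 1 / l * U \<longleftrightarrow> (A * Q - 1) * V \<le> A\<^sup>2 * U"
    proof -
      have "(A * Q - 1) / (A\<^sup>2 * l) * V = ((A * Q - 1) * V) / (A\<^sup>2 * l)" by simp
      moreover have "1 / l * U = (A\<^sup>2 * U) / (A\<^sup>2 * l)" using A by simp
      moreover have "A\<^sup>2 * l > 0" using A l by simp
      ultimately show ?thesis by (simp only: divide_le_cancel) auto
    qed
    also have "\<dots> \<longleftrightarrow> t * ((A * Q - 1) * V) \<le> t * (A\<^sup>2 * U)" using t by simp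
    also have "t * ((A * Q - 1) * V) = (A * Q - 1) * (Y + t / 3)"
      unfolding V_def using t by (simp add: field_simps)
    also have "t * (A\<^sup>2 * U) = A\<^sup>2 * X + t * A * Q / 3"
      unfolding U_def using t A by (simp add: field_simps power2_eq_square)
    also have "(A * Q - 1) * (Y + t / 3) = (A * Q - 1) * Y + t * A * Q / 3 - t / 3"
      by (simp add: field_simps)
    finally show ?thesis by linarith
  qed
  also have "1 / l * U + (l - (A * Q - 1) / (A\<^sup>2 * l)) * V \<le> l * (1 / l) \<longleftrightarrow>
      X + (l\<^sup>2 + 1 / A\<^sup>2 - Q / A) * Y \<le> t * (l - (l\<^sup>2 + 1 / A\<^sup>2) / 3)"
  proof -
    define k where "k = l\<^sup>2 + 1 / A\<^sup>2 - Q / A"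
    have "1 / l * U + (l - (A * Q - 1) / (A\<^sup>2 * l)) * V = (U + k * V) / l"
      unfolding k_def using A l by (simp add: field_simps power2_eq_square)
    then have "1 / l * U + (l - (A * Q - 1) / (A\<^sup>2 * l)) * V \<le> l * (1 / l) \<longleftrightarrow> U + k * V \<le> l"
      using l by (simp add: field_simps)
    also have "\<dots> \<longleftrightarrow> t * (U + k * V) \<le> t * l" using t by simp
    also have "t * (U + k * V) = X + k * Y + t * (Q / A + k) / 3"
      unfolding U_def V_def using t A by (simp add: field_simps)
    also have "\<dots> \<le> t * l \<longleftrightarrow> X + k * Y \<le> t * (l - (Q / A + k) / 3)"
      by (simp add: algebra_simps)
    finally show ?thesis unfolding k_def by simp
  qed
  finally show ?thesis .
qed

lemma ehrhart_eq_card_int: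
  "ehrhart P t = card {(x :: int, y :: int). (of_int x, of_int y) \<in> dilate (real t) P}"
proof -
  let ?f = "map_prod real_of_int real_of_int"
  have "dilate (real t) P \<inter> int_lattice = ?f ` {(x, y). (of_int x, of_int y) \<in> dilate (real t) P}"
    unfolding int_lattice_def by (auto elim!: Ints_cases simp: image_iff)
  moreover have "inj_on ?f S" for S by (auto intro!: inj_onI)
  ultimately show ?thesis unfolding ehrhart_def by (simp only: card_image)
qed

lemma ehrhart_at_0:
  assumes "P \<noteq> {}"
  shows "ehrhart P 0 = 1"
proof -
  have "dilate 0 P = {0}" unfolding dilate_def using assms by auto
  moreover have "{0} \<inter> int_lattice = {0}" unfolding int_lattice_def zero_prod_def by auto
  ultimately show ?thesis unfolding ehrhart_def by simp
qed

lemma ehrhart_dilate: "ehrhart (dilate (real k) P) t = ehrhart P (k * t)"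
  unfolding ehrhart_def dilate_def by (simp add: image_image mult.commute)

lemma of_int_le_third_iff: "real_of_int k \<le> real t / 3 \<longleftrightarrow> k \<le> int (t div 3)"
proof -
  have "real_of_int k \<le> real t / 3 \<longleftrightarrow> real_of_int (3 * k) \<le> real_of_int (int t)"
    by (simp add: field_simps)
  also have "\<dots> \<longleftrightarrow> 3 * k \<le> int t" by (simp only: of_int_le_iff)
  also have "\<dots> \<longleftrightarrow> k \<le> int (t div 3)" by presburger
  finally show ?thesis .
qed

text \<open>The first two levels are rounded to \<open>t div 3\<close> here, while the third
  inequality stays real: it rounds the same way for a Markov triple but has level 0 in the limit. At
  \<open>t = 0\<close> the dilate is a point, matched by \<open>card0\<close>.\<close>

lemma ehrhart_shifted_triangle:
  assumes l: "l > 0" and a: "a > 0" and card0: "card (R 0) = 1"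
    and R: "\<And>t. R (t div 3) = {(x, y). - y \<le> int (t div 3) \<and>
      (a * q - 1) * y - a\<^sup>2 * x \<le> int (t div 3) \<and>
      of_int x + (l\<^sup>2 + 1 / of_int a ^ 2 - of_int q / of_int a) * of_int y
        \<le> real t * (l - (l\<^sup>2 + 1 / of_int a ^ 2) / 3)}"
  shows "ehrhart (shifted_triangle a q l) t = card (R (t div 3))"
proof (cases "t = 0")
  case True
  then show ?thesis using card0 by (simp add: ehrhart_at_0 shifted_triangle_def)
next
  case False
  have "- real_of_int y \<le> real t / 3 \<longleftrightarrow> - y \<le> int (t div 3)" for y
    using of_int_le_third_iff[of "- y" t] by simp
  moreover have "(of_int a * of_int q - 1) * real_of_int y - (of_int a)\<^sup>2 * of_int x \<le> real t / 3
      \<longleftrightarrow> (a * q - 1) * y - a\<^sup>2 * x \<le> int (t div 3)" for x y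
    using of_int_le_third_iff[of "(a * q - 1) * y - a\<^sup>2 * x" t] by simp
  ultimately show ?thesis
    unfolding ehrhart_eq_card_int R
    using False l a by (simp add: mem_dilate_shifted_triangle)
qed

lemma ehrhart_markov_shifted_triangle:
  assumes mk: "markov_triple b a c" and p: "a * p = 3 * c - q * b"
  shows "real (ehrhart (shifted_triangle a q (of_int c / (of_int a * of_int b))) t)
    = 1 + 9 * real (t div 3) * (real (t div 3) + 1) / 2"
proof -
  have pos: "a > 0" "b > 0" "c > 0" and eq: "b\<^sup>2 + a\<^sup>2 + c\<^sup>2 = 3 * b * a * c"
    using mk unfolding markov_triple_def by auto
  define A B C P Q where "A = real_of_int a" and "B = real_of_int b" and "C = real_of_int c"
    and "P = real_of_int p" and "Q = real_of_int q"
  have rpos: "A > 0" "B > 0" "C > 0" using pos unfolding A_def B_def C_def by simp_all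
  have req: "B\<^sup>2 + A\<^sup>2 + C\<^sup>2 = 3 * B * A * C"
    using arg_cong[OF eq, of real_of_int] unfolding A_def B_def C_def by simp
  have rp: "A * P = 3 * C - Q * B"
    using arg_cong[OF p, of real_of_int] unfolding A_def B_def C_def P_def Q_def by simp
  define l where "l = C / (A * B)"
  have k: "l\<^sup>2 + 1 / A\<^sup>2 = (3 * B * C - A) / (A * B\<^sup>2)"
  proof -
    have "l\<^sup>2 + 1 / A\<^sup>2 = (C\<^sup>2 + B\<^sup>2) / (A\<^sup>2 * B\<^sup>2)"
      unfolding l_def using rpos by (simp add: field_simps)
    also have "C\<^sup>2 + B\<^sup>2 = A * (3 * B * C - A)" using req by algebra
    also have "A * (3 * B * C - A) / (A\<^sup>2 * B\<^sup>2) = (3 * B * C - A) / (A * B\<^sup>2)"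
      using rpos by (simp add: power2_eq_square)
    finally show ?thesis .
  qed
  \<comment> \<open>Multiplication by \<open>B^2\<close> clears the denominators of the third form;
    the choice of \<open>p\<close> gives the integer coefficient \<open>bp - 1\<close>, and
    \<open>k2\<close> gives the level \<open>t/3\<close>.\<close>
  have k1: "B\<^sup>2 * (l\<^sup>2 + 1 / A\<^sup>2 - Q / A) = B * P - 1"
  proof -
    have "B\<^sup>2 * (l\<^sup>2 + 1 / A\<^sup>2 - Q / A) = (3 * B * C - A - Q * B\<^sup>2) / A"
      unfolding k using rpos by (simp add: field_simps)
    also have "3 * B * C - A - Q * B\<^sup>2 = A * (B * P - 1)" using rp by algebra
    finally show ?thesis using rpos by simp
  qed
  have k2: "B\<^sup>2 * (l - (l\<^sup>2 + 1 / A\<^sup>2) / 3) = 1 / 3"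
    unfolding k unfolding l_def using rpos by (simp add: field_simps power2_eq_square)
  have hyp: "of_int x + (l\<^sup>2 + 1 / A\<^sup>2 - Q / A) * of_int y \<le> real t * (l - (l\<^sup>2 + 1 / A\<^sup>2) / 3)
      \<longleftrightarrow> b\<^sup>2 * x + (b * p - 1) * y \<le> int (t div 3)" for x y t
  proof -
    have "of_int x + (l\<^sup>2 + 1 / A\<^sup>2 - Q / A) * of_int y \<le> real t * (l - (l\<^sup>2 + 1 / A\<^sup>2) / 3) \<longleftrightarrow>
      B\<^sup>2 * (of_int x + (l\<^sup>2 + 1 / A\<^sup>2 - Q / A) * of_int y) \<le> B\<^sup>2 * (real t * (l - (l\<^sup>2 + 1 / A\<^sup>2) / 3))"
      using rpos by (intro mult_le_cancel_left_pos[symmetric]) simp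
    also have "B\<^sup>2 * (of_int x + (l\<^sup>2 + 1 / A\<^sup>2 - Q / A) * of_int y) =
        B\<^sup>2 * of_int x + (B\<^sup>2 * (l\<^sup>2 + 1 / A\<^sup>2 - Q / A)) * of_int y"
      by (simp only: distrib_left mult.assoc)
    also have "\<dots> = real_of_int (b\<^sup>2 * x + (b * p - 1) * y)"
      unfolding k1 by (simp add: B_def P_def)
    also have "B\<^sup>2 * (real t * (l - (l\<^sup>2 + 1 / A\<^sup>2) / 3)) = real t * (B\<^sup>2 * (l - (l\<^sup>2 + 1 / A\<^sup>2) / 3))"
      by (simp only: mult.left_commute)
    also have "\<dots> = real t / 3" unfolding k2 by simp
    finally show ?thesis unfolding of_int_le_third_iff .
  qed
  have "l > 0" unfolding l_def using rpos by simp
  moreover have "card (triangle_points a q b p 0) = 1"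
    using card_triangle_points[OF mk p, of 0] by simp
  moreover have "triangle_points a q b p (t div 3) = {(x, y). - y \<le> int (t div 3) \<and>
      (a * q - 1) * y - a\<^sup>2 * x \<le> int (t div 3) \<and>
      of_int x + (l\<^sup>2 + 1 / of_int a ^ 2 - of_int q / of_int a) * of_int y
        \<le> real t * (l - (l\<^sup>2 + 1 / of_int a ^ 2) / 3)}" for t
    unfolding triangle_points_def A_def[symmetric] Q_def[symmetric] hyp ..
  ultimately have "ehrhart (shifted_triangle a q l) t = card (triangle_points a q b p (t div 3))"
    using pos(1) by (intro ehrhart_shifted_triangle)
  then show ?thesis using card_triangle_points[OF mk p] unfolding l_def A_def B_def C_def by simp
qed

section \<open>Ehrhart function of the limit triangle\<close>

text \<open>Otherwise \<open>k = a (2 lambda - 3)\<close>, a square root of \<open>9a^2 - 4\<close>,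
  would be a rational algebraic integer and hence an integer. But \<open>9a^2 - 4\<close> lies
  strictly between the consecutive squares of \<open>3a - 1\<close> and \<open>3a\<close>.\<close>

lemma lambda_lim_irrational:
  assumes "a > 0"
  shows "lambda_lim a \<notin> \<rat>"
proof
  assume "lambda_lim a \<in> \<rat>"
  define A where "A = real_of_int a"
  have A: "A \<ge> 1" using assms unfolding A_def by simp
  then have "A\<^sup>2 \<ge> 1" by simp
  then have "4 / A\<^sup>2 \<le> 4 / 1" by (intro divide_left_mono) auto
  then have nn: "9 - 4 / A\<^sup>2 \<ge> 0" by simp
  define k where "k = A * (2 * lambda_lim a - 3)"
  have "k = A * sqrt (9 - 4 / A\<^sup>2)" unfolding k_def lambda_lim_def A_def by (simp add: field_simps)
  then have "k\<^sup>2 = A\<^sup>2 * (9 - 4 / A\<^sup>2)" using nn by (simp add: power_mult_distrib)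
  also have "\<dots> = 9 * A\<^sup>2 - 4" using A by (simp add: field_simps)
  finally have k2: "k\<^sup>2 = of_int (9 * a\<^sup>2 - 4)" unfolding A_def by simp
  have "k \<in> \<rat>" unfolding k_def A_def
    using \<open>lambda_lim a \<in> \<rat>\<close> by (intro Rats_mult Rats_diff) auto
  moreover have "algebraic_int k"
  proof (rule algebraic_int_root)
    show "algebraic_int (real_of_int (9 * a\<^sup>2 - 4))" by (intro int_imp_algebraic_int Ints_of_int)
    show "poly (monom 1 2) k = of_int (9 * a\<^sup>2 - 4)" using k2 by (simp add: poly_monom)
  qed (simp_all add: degree_monom_eq)
  ultimately obtain m where "k = of_int m"
    using rational_algebraic_int_is_int by (metis Ints_cases)
  then have "m\<^sup>2 = 9 * a\<^sup>2 - 4" using k2 by (metis of_int_eq_iff of_int_power)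
  then have m: "\<bar>m\<bar>\<^sup>2 = (3 * a)\<^sup>2 - 4" by (simp add: power_mult_distrib)
  have "\<bar>m\<bar>\<^sup>2 < (3 * a)\<^sup>2" using m by simp
  then have "\<bar>m\<bar> < 3 * a" by (rule power2_less_imp_less) (use assms in simp)
  then have "\<bar>m\<bar>\<^sup>2 \<le> (3 * a - 1)\<^sup>2" by (intro power_mono) simp_all
  also have "(3 * a - 1)\<^sup>2 = (3 * a)\<^sup>2 - 6 * a + 1" by (simp add: power2_eq_square algebra_simps)
  finally have "6 * a \<le> 5" using m by linarith
  then show False using assms by simp
qed

lemma ehrhart_limit_triangle:
  assumes a: "a > 0"
  shows "real (ehrhart (shifted_triangle a q (lambda_lim a)) t)
    = 1 + 9 * real (t div 3) * (real (t div 3) + 1) / 2"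
proof -
  define A Q where "A = real_of_int a" and "Q = real_of_int q"
  define l where "l = lambda_lim a"
  have A: "A \<ge> 1" using assms unfolding A_def by simp
  then have "A\<^sup>2 \<ge> 1" by simp
  then have "4 / A\<^sup>2 \<le> 4 / 1" by (intro divide_left_mono) auto
  then have nn: "9 - 4 / A\<^sup>2 \<ge> 0" by simp
  have l: "l > 0" unfolding l_def lambda_lim_def A_def[symmetric] using nn
    by (simp add: add_pos_nonneg)
  have "2 * l - 3 = sqrt (9 - 4 / A\<^sup>2)"
    unfolding l_def lambda_lim_def A_def by (simp add: field_simps)
  then have "(2 * l - 3)\<^sup>2 = 9 - 4 / A\<^sup>2" using nn by simp
  \<comment> \<open>This equation makes the level \<open>t (l - (l^2 + 1/A^2)/3)\<close> of the
    third edge vanish for every \<open>t\<close>.\<close>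
  then have q: "l\<^sup>2 + 1 / A\<^sup>2 = 3 * l" by (simp add: power2_eq_square algebra_simps)
  have "A\<^sup>2 * (l\<^sup>2 + 1 / A\<^sup>2) = A\<^sup>2 * (3 * l)" by (simp only: q)
  moreover have "A\<^sup>2 * (l\<^sup>2 + 1 / A\<^sup>2) = A\<^sup>2 * l\<^sup>2 + 1" using A by (simp add: field_simps)
  ultimately have "A\<^sup>2 * l * (3 - l) = 1" by (simp add: power2_eq_square algebra_simps)
  then have l2: "of_int (a\<^sup>2) * l * (3 - l) = 1" unfolding A_def by simp
  note card = card_limit_points[OF a l l2 lambda_lim_irrational[OF a, folded l_def]]
  have hyp: "A * of_int x + (3 * A * l - Q) * of_int y \<le> 0 \<longleftrightarrow>
      of_int x + (3 * l - Q / A) * of_int y \<le> real t * (l - 3 * l / 3)" for x y and t :: nat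
  proof -
    have "A * of_int x + (3 * A * l - Q) * of_int y = A * (of_int x + (3 * l - Q / A) * of_int y)"
      using A by (simp add: field_simps)
    then show ?thesis using A by (simp add: mult_le_0_iff)
  qed
  have "card (limit_points a q l 0) = 1" using card[of _ 0] by simp
  moreover have "limit_points a q l (t div 3) = {(x, y). - y \<le> int (t div 3) \<and>
      (a * q - 1) * y - a\<^sup>2 * x \<le> int (t div 3) \<and>
      of_int x + (l\<^sup>2 + 1 / of_int a ^ 2 - of_int q / of_int a) * of_int y
        \<le> real t * (l - (l\<^sup>2 + 1 / of_int a ^ 2) / 3)}" for t
    unfolding limit_points_def A_def[symmetric] Q_def[symmetric] q hyp[of _ _ t] ..
  ultimately have "ehrhart (shifted_triangle a q l) t = card (limit_points a q l (t div 3))"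
    using a l by (intro ehrhart_shifted_triangle)
  then show ?thesis using card unfolding l_def by simp
qed

section \<open>The recursion and the conclusion\<close>

text \<open>The recursion is a Vieta jump that keeps \<open>a\<close> and replaces
  \<open>b_n\<close>. The divisibility is the congruence defining \<open>q\<close> with the inverse
  cleared; it provides the integer \<open>p\<close> at every stage.\<close>

lemma markov_seq_invariant:
  assumes mk: "markov_triple b a c" and q: "a dvd 3 * c - q * b"
  shows "markov_triple (b_seq a b c n) a (c_seq a b c n)
    \<and> a dvd 3 * c_seq a b c n - q * b_seq a b c n"
proof (induction n)
  case 0
  then show ?case using assms by simp
next
  case (Suc n)
  define u v where "u = b_seq a b c n" and "v = c_seq a b c n"
  have mk: "markov_triple u a v" and d: "a dvd 3 * v - q * u"
    using Suc unfolding u_def v_def by auto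
  have pos: "u > 0" "a > 0" "v > 0" and eq: "u\<^sup>2 + a\<^sup>2 + v\<^sup>2 = 3 * u * a * v"
    using mk unfolding markov_triple_def by auto
  have "u * (3 * a * v - u) = a\<^sup>2 + v\<^sup>2" using eq by algebra
  moreover have "a\<^sup>2 + v\<^sup>2 > 0" using pos by (simp add: add_pos_pos)
  ultimately have "3 * a * v - u > 0" using pos by (metis zero_less_mult_pos)
  moreover have "v\<^sup>2 + a\<^sup>2 + (3 * a * v - u)\<^sup>2 = 3 * v * a * (3 * a * v - u)" using eq by algebra
  ultimately have m: "markov_triple v a (3 * a * v - u)" using pos unfolding markov_triple_def by simp
  \<comment> \<open>Modulo \<open>a\<close>, \<open>qu = 3v\<close> and
    \<open>u^2 + v^2 = 0\<close>, so \<open>u (3u + qv)\<close> vanishes; \<open>u\<close> is a unit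
    modulo \<open>a\<close> and cancels.\<close>
  have "u * (3 * u + q * v) = 3 * a * (3 * u * v - a) - v * (3 * v - q * u)" using eq by algebra
  then have "a dvd u * (3 * u + q * v)" using d by simp
  moreover have "coprime a u" using markov_coprime[OF mk] by (simp add: coprime_commute)
  ultimately have "a dvd 3 * u + q * v" by (simp add: coprime_dvd_mult_right_iff)
  then have "a dvd 9 * a * v - (3 * u + q * v)" by simp
  also have "9 * a * v - (3 * u + q * v) = 3 * (3 * a * v - u) - q * v" by simp
  finally show ?case using m unfolding u_def v_def by simp
qed

lemma markov_triangle_eq:
  assumes "a > 0" "b_seq a b c n > 0" "c_seq a b c n > 0"
  shows "markov_triangle a b c q n =
    shifted_triangle a q (of_int (c_seq a b c n) / (of_int a * of_int (b_seq a b c n)))"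
proof -
  have "of_int a * of_int (b_seq a b c n) / real_of_int (c_seq a b c n)
      = 1 / (of_int (c_seq a b c n) / (of_int a * of_int (b_seq a b c n)))"
    by simp
  moreover have "(real_of_int a * of_int q - 1) * of_int (b_seq a b c n) / (of_int a * of_int (c_seq a b c n))
      = (of_int a * of_int q - 1) / (of_int a ^ 2 * (of_int (c_seq a b c n) / (of_int a * of_int (b_seq a b c n))))"
    using assms by (simp add: field_simps power2_eq_square)
  ultimately show ?thesis unfolding markov_triangle_def shifted_triangle_def Let_def by simp
qed

lemma markov_triangle_lim_eq:
  assumes "a > 0"
  shows "markov_triangle_lim a q = shifted_triangle a q (lambda_lim a)"
  unfolding markov_triangle_lim_def shifted_triangle_def Let_def
  using assms by (simp add: field_simps)

theorem mainTheorem2: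
  fixes a b c q :: int
  assumes "markov_triple b a c"
    and "b \<le> a" and "c \<le> a"
    and "[q = 3 * c * modular_inverse a b] (mod a)"
  shows "(\<forall>n\<ge>1. ehrhart_equivalent (markov_triangle_lim a q) (markov_triangle a b c q n))
         \<and> pseudo_integral (dilate 3 (markov_triangle_lim a q))"
proof
  have pos: "a > 0" using assms(1) unfolding markov_triple_def by simp
  have "[q * b = 3 * c * (modular_inverse a b * b)] (mod a)"
    using cong_mult[OF assms(4) cong_refl[of b]] by (simp add: mult.assoc)
  also have "[3 * c * (modular_inverse a b * b) = 3 * c * 1] (mod a)"
    using cong_modular_inverse2[OF markov_coprime[OF assms(1)]] by (intro cong_mult cong_refl)
  finally have "a dvd 3 * c - q * b"
    by (simp add: cong_iff_dvd_diff dvd_diff_commute)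
  note inv = markov_seq_invariant[OF assms(1) this]
  have lim: "real (ehrhart (markov_triangle_lim a q) t)
      = 1 + 9 * real (t div 3) * (real (t div 3) + 1) / 2" for t
    using ehrhart_limit_triangle pos markov_triangle_lim_eq by simp
  show "\<forall>n\<ge>1. ehrhart_equivalent (markov_triangle_lim a q) (markov_triangle a b c q n)"
  proof (intro allI impI)
    fix n :: nat
    have mk: "markov_triple (b_seq a b c n) a (c_seq a b c n)" using inv by blast
    obtain p where "a * p = 3 * c_seq a b c n - q * b_seq a b c n" using inv[of n] by (metis dvdE)
    note fin = ehrhart_markov_shifted_triangle[OF mk this]
    have "b_seq a b c n > 0" "c_seq a b c n > 0" using mk unfolding markov_triple_def by auto
    note eq = markov_triangle_eq[OF pos this]
    have "real (ehrhart (markov_triangle_lim a q) t) = real (ehrhart (markov_triangle a b c q n) t)" for t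
      unfolding lim eq fin ..
    then show "ehrhart_equivalent (markov_triangle_lim a q) (markov_triangle a b c q n)"
      unfolding ehrhart_equivalent_def by simp
  qed
  \<comment> \<open>Dilating by 3 replaces \<open>t\<close> by \<open>3t\<close>, so
    \<open>t div 3\<close> becomes \<open>t\<close> and the common formula a polynomial.\<close>
  have "real (ehrhart (dilate 3 (markov_triangle_lim a q)) t) = poly [:1, 9 / 2, 9 / 2:] (real t)" for t
    using ehrhart_dilate[of 3 "markov_triangle_lim a q" t] lim[of "3 * t"] by (simp add: field_simps)
  then show "pseudo_integral (dilate 3 (markov_triangle_lim a q))"
    unfolding pseudo_integral_def by blast
qed

end
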